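(* Let $\mathcal X\subseteq\mathbb R^n$ be open and consider a port-Hamiltonian descriptor system (pHDAE) on $\mathcal X$ with coefficients $E,J,R,B,z$ and Hamiltonian $\mathcal H\in C^1(\mathcal X,\mathbb R)$. Let $(\overline E,\overline z)$ be a discrete gradient pair for $(\mathcal H,E,z)$ and let $\overline J,\overline R,\overline B$ be consistent approximations of $J,R,B$ such that pointwise $\overline J=-\overline J^\top$ and $\overline R=\overline R^\top\succeq 0$. Let $h>0$, and suppose that $x^k,x^{k+1}\in\mathcal X$ and $u^{k,k+1},y^{k,k+1}\in\mathbb R^m$ satisfy $$\overline E(x^k,x^{k+1})(x^{k+1}-x^k)=h\big(\overline J(x^k,x^{k+1})-\overline R(x^k,x^{k+1})\big)\overline z(x^k,x^{k+1})+h\overline B(x^k,x^{k+1})u^{k,k+1},$$ $$y^{k,k+1}=\overline B(x^k,x^{k+1})^\top\overline z(x^k,x^{k+1}).$$ Then $$\mathcal H(x^{k+1})-\mathcal H(x^k)=-h\,\overline z(x^k,x^{k+1})^\top\overline R(x^k,x^{k+1})\,\overline z(x^k,x^{k+1})+h\,(y^{k,k+1})^\top u^{k,k+1}\le h\,(y^{k,k+1})^\top u^{k,k+1}.$$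
   Context: $\mathcal X\subseteq\mathbb R^n$ is open; gradients are column vectors. For $\mathcal H\in C^1(\mathcal X,\mathbb R)$, $E\in C(\mathcal X,\mathbb R^{n,n})$, $z\in C(\mathcal X,\mathbb R^n)$, the pair $(E,z)$ is a gradient pair for $\mathcal H$ if $E(x)^\top z(x)=\nabla\mathcal H(x)$ for all $x\in\mathcal X$. A pHDAE is a system $E(x)\dot x=(J(x)-R(x))z(x)+B(x)u$, $y=B(x)^\top z(x)$ together with a Hamiltonian $\mathcal H\in C^1(\mathcal X,\mathbb R)$, where $E,J,R\in C(\mathcal X,\mathbb R^{n,n})$, $B\in C(\mathcal X,\mathbb R^{n,m})$, $z\in C(\mathcal X,\mathbb R^n)$, $J=-J^\top$ and $R=R^\top\succeq0$ pointwise, and $(E,z)$ is a gradient pair for $\mathcal H$. A continuous function $\overline F$ on $\mathcal X\times\mathcal X$ is a consistent approximation (discretization) of a continuous function $F$ on $\mathcal X$ (vector- or matrix-valued) if $\overline F(x,x)=F(x)$ for all $x\in\mathcal X$. If $(E,z)$ is a gradient pair for $\mathcal H$, then $(\overline E,\overline z)\in C(\mathcal X\times\mathcal X,\mathbb R^{n,n})\times C(\mathcal X\times\mathcal X,\mathbb R^n)$ is a discrete gradient pair for $(\mathcal H,E,z)$ if (i) $\overline z(x,x')^\top\overline E(x,x')(x'-x)=\mathcal H(x')-\mathcal H(x)$ for all $x,x'\in\mathcal X$, (ii) $\overline E(x,x)=E(x)$ and (iii) $\overline z(x,x)=z(x)$ for all $x\in\mathcal X$. *)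

theory Defs
  imports "HOL-Analysis.Analysis"
begin

definition C1_real_on :: "(real^'n) set \<Rightarrow> (real^'n \<Rightarrow> real) \<Rightarrow> bool" where
  "C1_real_on X H \<longleftrightarrow>
     (\<exists>g. (\<forall>x\<in>X. GDERIV H x :> g x) \<and> continuous_on X g)"

definition skew_symmetric :: "real^'n^'n \<Rightarrow> bool" where
  "skew_symmetric A \<longleftrightarrow> A = - transpose A"

definition sym_pos_semidef :: "real^'n^'n \<Rightarrow> bool" where
  "sym_pos_semidef A \<longleftrightarrow> A = transpose A \<and> (\<forall>v. 0 \<le> v \<bullet> (A *v v))"

definition gradient_pair ::
    "(real^'n) set \<Rightarrow> (real^'n \<Rightarrow> real) \<Rightarrow> (real^'n \<Rightarrow> real^'n^'n) \<Rightarrow> (real^'n \<Rightarrow> real^'n) \<Rightarrow> bool" where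
  "gradient_pair X H E z \<longleftrightarrow>
     C1_real_on X H \<and> continuous_on X E \<and> continuous_on X z \<and>
     (\<forall>x\<in>X. GDERIV H x :> transpose (E x) *v z x)"

text \<open>A pHDAE is represented by its coefficients and its Hamiltonian: they determine the system
  \<open>E(x) x' = (J(x) - R(x)) z(x) + B(x) u\<close>, \<open>y = B(x)\<^sup>T z(x)\<close>, and the predicate collects the
  conditions imposed on them. State dimension and number of inputs are \<open>CARD('n)\<close> and
  \<open>CARD('m)\<close>.\<close>

definition pHDAE ::
    "(real^'n) set \<Rightarrow> (real^'n \<Rightarrow> real^'n^'n) \<Rightarrow> (real^'n \<Rightarrow> real^'n^'n) \<Rightarrow> (real^'n \<Rightarrow> real^'n^'n) \<Rightarrow>
     (real^'n \<Rightarrow> real^'m^'n) \<Rightarrow> (real^'n \<Rightarrow> real^'n) \<Rightarrow> (real^'n \<Rightarrow> real) \<Rightarrow> bool" where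
  "pHDAE X E J R B z H \<longleftrightarrow>
     continuous_on X J \<and> continuous_on X R \<and> continuous_on X B \<and>
     (\<forall>x\<in>X. skew_symmetric (J x)) \<and> (\<forall>x\<in>X. sym_pos_semidef (R x)) \<and>
     gradient_pair X H E z"

definition consistent_approx ::
    "'a::topological_space set \<Rightarrow> ('a \<Rightarrow> 'b::topological_space) \<Rightarrow> ('a \<Rightarrow> 'a \<Rightarrow> 'b) \<Rightarrow> bool" where
  "consistent_approx X F Fb \<longleftrightarrow>
     continuous_on X F \<and> continuous_on (X \<times> X) (\<lambda>(x, x'). Fb x x') \<and> (\<forall>x\<in>X. Fb x x = F x)"

definition discrete_gradient_pair ::
    "(real^'n) set \<Rightarrow> (real^'n \<Rightarrow> real) \<Rightarrow> (real^'n \<Rightarrow> real^'n^'n) \<Rightarrow> (real^'n \<Rightarrow> real^'n) \<Rightarrow>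
     (real^'n \<Rightarrow> real^'n \<Rightarrow> real^'n^'n) \<Rightarrow> (real^'n \<Rightarrow> real^'n \<Rightarrow> real^'n) \<Rightarrow> bool" where
  "discrete_gradient_pair X H E z Eb zb \<longleftrightarrow>
     gradient_pair X H E z \<and>
     continuous_on (X \<times> X) (\<lambda>(x, x'). Eb x x') \<and>
     continuous_on (X \<times> X) (\<lambda>(x, x'). zb x x') \<and>
     (\<forall>x\<in>X. \<forall>x'\<in>X. zb x x' \<bullet> (Eb x x' *v (x' - x)) = H x' - H x) \<and>
     (\<forall>x\<in>X. Eb x x = E x) \<and>
     (\<forall>x\<in>X. zb x x = z x)"

end

theory Submission
  imports Defs
begin

text \<open>The discrete gradient property turns the increment of \<open>H\<close> into the pairing
  of \<open>zb x x'\<close> with \<open>Eb x x' *v (x' - x)\<close>, exactly and with no Taylor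
  remainder. Substituting the scheme splits this pairing into three terms: the \<open>Jb\<close>
  term vanishes because a skew-symmetric matrix has zero quadratic form
  (\<open>skew_symmetric_inner_eq_0\<close>), the \<open>Rb\<close> term is the dissipation, and the
  \<open>Bb\<close> term is the supplied power. Semidefiniteness of \<open>Rb\<close> and
  \<open>h > 0\<close> then give the inequality.\<close>

lemma skew_symmetric_inner_eq_0:
  assumes "skew_symmetric A"
  shows "v \<bullet> (A *v v) = 0"
proof -
  have "A + transpose A = 0"
    using assms unfolding skew_symmetric_def by (metis add.left_inverse)
  \<comment> \<open>The row product \<open>v v* A\<close> stands for
    \<open>transpose A *v v\<close>. Both summands pair with \<open>v\<close> to the same scalar, so
    twice the quadratic form is zero.\<close>
  then have "A *v v + v v* A = 0"
    by (metis matrix_vector_mult_add_rdistrib matrix_vector_mult_0 transpose_matrix_vector)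
  then have "v \<bullet> (A *v v) + v \<bullet> (v v* A) = 0"
    by (metis inner_add_right inner_zero_right)
  moreover have "v \<bullet> (v v* A) = v \<bullet> (A *v v)"
    by (metis dot_lmul_matrix inner_commute)
  ultimately show ?thesis by simp
qed

theorem theorem4p1:
  fixes X :: "(real^'n) set"
    and H :: "real^'n \<Rightarrow> real"
    and E J R :: "real^'n \<Rightarrow> real^'n^'n"
    and B :: "real^'n \<Rightarrow> real^'m^'n"
    and z :: "real^'n \<Rightarrow> real^'n"
    and Eb Jb Rb :: "real^'n \<Rightarrow> real^'n \<Rightarrow> real^'n^'n"
    and Bb :: "real^'n \<Rightarrow> real^'n \<Rightarrow> real^'m^'n"
    and zb :: "real^'n \<Rightarrow> real^'n \<Rightarrow> real^'n"
    and h :: real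
    and x x' :: "real^'n"
    and u y :: "real^'m"
  assumes "open X"
    and "pHDAE X E J R B z H"
    and "discrete_gradient_pair X H E z Eb zb"
    and "consistent_approx X J Jb"
    and "consistent_approx X R Rb"
    and "consistent_approx X B Bb"
    and "\<forall>a\<in>X. \<forall>b\<in>X. skew_symmetric (Jb a b)"
    and "\<forall>a\<in>X. \<forall>b\<in>X. sym_pos_semidef (Rb a b)"
    and "h > 0"
    and "x \<in> X" and "x' \<in> X"
    and "Eb x x' *v (x' - x) = h *\<^sub>R ((Jb x x' - Rb x x') *v zb x x') + h *\<^sub>R (Bb x x' *v u)"
    and "y = transpose (Bb x x') *v zb x x'"
  shows "H x' - H x = - h * (zb x x' \<bullet> (Rb x x' *v zb x x')) + h * (y \<bullet> u)
       \<and> - h * (zb x x' \<bullet> (Rb x x' *v zb x x')) + h * (y \<bullet> u) \<le> h * (y \<bullet> u)"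
proof -
  let ?z = "zb x x'"
  have "H x' - H x = ?z \<bullet> (Eb x x' *v (x' - x))"
    using assms(3,10,11) by (simp add: discrete_gradient_pair_def)
  also have "\<dots> = h * (?z \<bullet> (Jb x x' *v ?z)) - h * (?z \<bullet> (Rb x x' *v ?z)) + h * (?z \<bullet> (Bb x x' *v u))"
    unfolding assms(12)
    by (simp add: inner_add_right inner_diff_right matrix_vector_mult_diff_rdistrib right_diff_distrib)
  also have "?z \<bullet> (Jb x x' *v ?z) = 0"
    using assms(7,10,11) by (simp add: skew_symmetric_inner_eq_0)
  \<comment> \<open>The output uses the transpose of the same \<open>Bb x x'\<close> that feeds in
    \<open>u\<close>, so moving it across the inner product produces \<open>y\<close>.\<close>
  also have "?z \<bullet> (Bb x x' *v u) = y \<bullet> u"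
    unfolding assms(13) by (simp add: dot_lmul_matrix)
  finally have "H x' - H x = - h * (?z \<bullet> (Rb x x' *v ?z)) + h * (y \<bullet> u)"
    by simp
  moreover have "0 \<le> ?z \<bullet> (Rb x x' *v ?z)"
    using assms(8,10,11) by (simp add: sym_pos_semidef_def)
  ultimately show ?thesis
    using \<open>h > 0\<close> by simp
qed

end
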